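(* Let $\gamma_{ab}(q)$ be a metric on an $n$-dimensional manifold and $E_0$ a fixed constant, and consider the geodesic equations $\ddot q^a+\Gamma^a_{bc}\dot q^b\dot q^c=0$ subject to the constraint $\gamma_{ab}\dot q^a\dot q^b=2E_0$. Then each of the following is a first integral of this constrained system: Integral 1. For $\ell\ge0$, $$I_{(\ell)1}=\Big(-\sum_{k=1}^{\ell}\frac{t^{2k}}{2k}L_{(2k-1)(a;b)}+C_{(0)ab}\Big)\dot q^a\dot q^b+\sum_{k=1}^{\ell}t^{2k-1}L_{(2k-1)a}\dot q^a+G(q),$$ where $C_{(0)ab}$ is a second order CKT with associated vector $X_{(0)a}$, each $L_{(2k-1)(a;b)}$ ($k=1,\dots,\ell$) is a second order CKT with associated vector $Y_{(2k-1)a}$, and $$E_0Y_{(2\ell-1)a}=0,\qquad E_0Y_{(2k-1)a}=k(2k+1)L_{(2k+1)a}\ (k=1,\dots,\ell-1),\qquad G_{,a}=-2E_0X_{(0)a}-L_{(1)a},$$ where $L_{(1)a}$ is present only if $\ell>0$. Integral 2. For $\ell\ge0$, $$I_{(\ell)2}=\sum_{k=0}^{\ell}\Big(-\frac{t^{2k+1}}{2k+1}L_{(2k)(a;b)}\dot q^a\dot q^b+t^{2k}L_{(2k)a}\dot q^a\Big),$$ where each $L_{(2k)(a;b)}$ ($k=0,\dots,\ell$) is a second order CKT with associated vector $Y_{(2k)a}$ and $$E_0Y_{(2\ell)a}=0,\qquad E_0Y_{(2k)a}=(k+1)(2k+1)L_{(2k+2)a}\ (k=0,\dots,\ell-1).$$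 Integral 3. For a constant $\lambda\ne0$, $$I_{(e)}=e^{\lambda t}\big(-L_{(a;b)}\dot q^a\dot q^b+\lambda L_a\dot q^a\big),$$ where $L_{(a;b)}$ is a second order CKT with associated vector $Y_a$ and $L_a=\frac{2E_0}{\lambda^2}Y_a$.
   Context: $\Gamma^a_{bc}$ are the Levi-Civita connection coefficients of $\gamma_{ab}$; comma = partial derivative, semicolon = covariant derivative, dot = $d/dt$; round brackets denote symmetrization with weight $1/N!$. A first integral of the constrained system is a function $I(t,q,\dot q)$ with $dI/dt=0$ along every geodesic solution satisfying $\gamma_{ab}\dot q^a\dot q^b=2E_0$. A symmetric tensor $U_{ab}$ is a second order conformal Killing tensor (CKT) with associated vector $u_a$ if $U_{(ab;c)}=u_{(a}\gamma_{bc)}$; if $u_a=0$ it is a Killing tensor (KT). *)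

theory Defs
  imports "HOL-Analysis.Analysis"
begin

text \<open>Local coordinate description: the manifold is represented by an open coordinate
  domain U in real^'n (n = CARD('n)); q = (q^a) are coordinates, vectors and covectors
  are given by their components.\<close>

definition pd :: "(real^'n \<Rightarrow> real) \<Rightarrow> 'n \<Rightarrow> real^'n \<Rightarrow> real" where
  "pd f c q = deriv (\<lambda>s. f (q + s *\<^sub>R axis c 1)) 0"

primrec pds :: "'n list \<Rightarrow> (real^'n \<Rightarrow> real) \<Rightarrow> (real^'n \<Rightarrow> real)" where
  "pds [] f = f"
| "pds (c # cs) f = pd (pds cs f) c"

definition smooth_fun :: "(real^'n) set \<Rightarrow> (real^'n \<Rightarrow> real) \<Rightarrow> bool" where
  "smooth_fun U f \<longleftrightarrow> (\<forall>cs. \<forall>q\<in>U. pds cs f differentiable (at q))"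

definition smooth_covec :: "(real^'n) set \<Rightarrow> (real^'n \<Rightarrow> 'n \<Rightarrow> real) \<Rightarrow> bool" where
  "smooth_covec U L \<longleftrightarrow> (\<forall>a. smooth_fun U (\<lambda>q. L q a))"

definition smooth_tensor2 :: "(real^'n) set \<Rightarrow> (real^'n \<Rightarrow> 'n \<Rightarrow> 'n \<Rightarrow> real) \<Rightarrow> bool" where
  "smooth_tensor2 U T \<longleftrightarrow> (\<forall>a b. smooth_fun U (\<lambda>q. T q a b))"

definition is_metric :: "(real^'n) set \<Rightarrow> (real^'n \<Rightarrow> 'n \<Rightarrow> 'n \<Rightarrow> real) \<Rightarrow> bool" where
  "is_metric U g \<longleftrightarrow> open U \<and> smooth_tensor2 U g \<and>
     (\<forall>q\<in>U. (\<forall>a b. g q a b = g q b a) \<and> det (\<chi> i j. g q i j) \<noteq> 0)"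

definition ginv :: "(real^'n \<Rightarrow> 'n \<Rightarrow> 'n \<Rightarrow> real) \<Rightarrow> real^'n \<Rightarrow> 'n \<Rightarrow> 'n \<Rightarrow> real" where
  "ginv g q a b = matrix_inv (\<chi> i j. g q i j) $ a $ b"

definition Gamma :: "(real^'n \<Rightarrow> 'n \<Rightarrow> 'n \<Rightarrow> real) \<Rightarrow> real^'n \<Rightarrow> 'n \<Rightarrow> 'n \<Rightarrow> 'n \<Rightarrow> real" where
  "Gamma g q a b c = (1/2) * (\<Sum>d\<in>UNIV. ginv g q a d *
      (pd (\<lambda>p. g p d b) c q + pd (\<lambda>p. g p d c) b q - pd (\<lambda>p. g p b c) d q))"

definition cov1 :: "(real^'n \<Rightarrow> 'n \<Rightarrow> 'n \<Rightarrow> real) \<Rightarrow> (real^'n \<Rightarrow> 'n \<Rightarrow> real) \<Rightarrow> real^'n \<Rightarrow> 'n \<Rightarrow> 'n \<Rightarrow> real" where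
  "cov1 g L q a b = pd (\<lambda>p. L p a) b q - (\<Sum>c\<in>UNIV. Gamma g q c a b * L q c)"

definition symcov1 :: "(real^'n \<Rightarrow> 'n \<Rightarrow> 'n \<Rightarrow> real) \<Rightarrow> (real^'n \<Rightarrow> 'n \<Rightarrow> real) \<Rightarrow> real^'n \<Rightarrow> 'n \<Rightarrow> 'n \<Rightarrow> real" where
  "symcov1 g L q a b = (cov1 g L q a b + cov1 g L q b a) / 2"

definition cov2 :: "(real^'n \<Rightarrow> 'n \<Rightarrow> 'n \<Rightarrow> real) \<Rightarrow> (real^'n \<Rightarrow> 'n \<Rightarrow> 'n \<Rightarrow> real) \<Rightarrow> real^'n \<Rightarrow> 'n \<Rightarrow> 'n \<Rightarrow> 'n \<Rightarrow> real" where
  "cov2 g C q a b c = pd (\<lambda>p. C p a b) c q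
      - (\<Sum>d\<in>UNIV. Gamma g q d a c * C q d b) - (\<Sum>d\<in>UNIV. Gamma g q d b c * C q a d)"

definition sym3 :: "('n \<Rightarrow> 'n \<Rightarrow> 'n \<Rightarrow> real) \<Rightarrow> 'n \<Rightarrow> 'n \<Rightarrow> 'n \<Rightarrow> real" where
  "sym3 T a b c = (T a b c + T a c b + T b a c + T b c a + T c a b + T c b a) / 6"

definition is_CKT :: "(real^'n) set \<Rightarrow> (real^'n \<Rightarrow> 'n \<Rightarrow> 'n \<Rightarrow> real) \<Rightarrow>
     (real^'n \<Rightarrow> 'n \<Rightarrow> 'n \<Rightarrow> real) \<Rightarrow> (real^'n \<Rightarrow> 'n \<Rightarrow> real) \<Rightarrow> bool" where
  "is_CKT U g T u \<longleftrightarrow> (\<forall>q\<in>U. (\<forall>a b. T q a b = T q b a) \<and>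
      (\<forall>a b c. sym3 (cov2 g T q) a b c = sym3 (\<lambda>x y z. u q x * g q y z) a b c))"

definition first_integral :: "(real^'n) set \<Rightarrow> (real^'n \<Rightarrow> 'n \<Rightarrow> 'n \<Rightarrow> real) \<Rightarrow> real \<Rightarrow>
     (real \<Rightarrow> real^'n \<Rightarrow> real^'n \<Rightarrow> real) \<Rightarrow> bool" where
  "first_integral U g E0 I \<longleftrightarrow>
    (\<forall>(J::real set) (q::real \<Rightarrow> real^'n) v acc. open J \<and>
       (\<forall>t\<in>J. q t \<in> U \<and> (q has_vector_derivative v t) (at t) \<and>
               (v has_vector_derivative acc t) (at t) \<and>
               (\<forall>a. acc t $ a + (\<Sum>b\<in>UNIV. \<Sum>c\<in>UNIV. Gamma g (q t) a b c * v t $ b * v t $ c) = 0) \<and>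
               (\<Sum>a\<in>UNIV. \<Sum>b\<in>UNIV. g (q t) a b * v t $ a * v t $ b) = 2 * E0)
     \<longrightarrow> (\<forall>t\<in>J. ((\<lambda>s. I s (q s) (v s)) has_real_derivative 0) (at t)))"

end

theory Submission
  imports Defs
begin

text \<open>Along a solution, the derivative of L_a q'^a is L_(a;b) q'^a q'^b, and the derivative of
  T_ab q'^a q'^b is T_(ab;c) q'^a q'^b q'^c; for a conformal Killing tensor with vector u the latter
  equals (u_a q'^a)(gamma_bc q'^b q'^c) = 2 E0 u_a q'^a on the constraint surface. Hence with
  P_k = L_(k)a q'^a and S_k = L_(k)(a;b) q'^a q'^b we have P_k' = S_k and S_k' = 2 E0 Y_(k)a q'^a.
  Each pair -t^m/m S_k + t^(m-1) P_k therefore has derivative -2 E0 t^m/m Y_(k)a q'^a + (m-1) t^(m-2) P_k,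
  and the recursions relating E0 Y_(k) to L_(k+2) make the resulting series telescope. In the first
  integral the leftover P_1 and the derivative of C_ab q'^a q'^b are cancelled by G; in the
  exponential integral e^(lam t) plays the role of the powers. The chain rule needs Gamma to be
  differentiable, which follows from Cramer's rule for the inverse metric.\<close>

definition contract1 :: "(real^'n \<Rightarrow> 'n \<Rightarrow> real) \<Rightarrow> real^'n \<Rightarrow> real^'n \<Rightarrow> real" where
  "contract1 L q x = (\<Sum>a\<in>UNIV. L q a * x $ a)"

definition contract2 :: "(real^'n \<Rightarrow> 'n \<Rightarrow> 'n \<Rightarrow> real) \<Rightarrow> real^'n \<Rightarrow> real^'n \<Rightarrow> real" where
  "contract2 T q x = (\<Sum>a\<in>UNIV. \<Sum>b\<in>UNIV. T q a b * x $ a * x $ b)"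

subsection \<open>Smoothness of the connection\<close>

lemma differentiable_prod:
  fixes f :: "'i \<Rightarrow> 'a::real_normed_vector \<Rightarrow> real"
  assumes "finite I" "\<And>i. i \<in> I \<Longrightarrow> f i differentiable (at x)"
  shows "(\<lambda>p. \<Prod>i\<in>I. f i p) differentiable (at x)"
  using assms by (induction I rule: finite_induct) auto

lemma det_differentiable:
  assumes "\<And>i j. (\<lambda>p. f p i j) differentiable (at x)"
  shows "(\<lambda>p. det ((\<chi> i j. f p i j) :: real^'n^'n)) differentiable (at x)"
proof -
  have "(\<lambda>p. \<Sum>s\<in>{s. s permutes (UNIV::'n set)}. of_int (sign s) * (\<Prod>i\<in>UNIV. f p i (s i)))
      differentiable (at x)"
    by (intro differentiable_sum differentiable_mult differentiable_const differentiable_prod ballI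
        finite_permutations assms) auto
  then show ?thesis by (simp add: det_def)
qed

lemma matrix_inv_nth_cramer:
  fixes A :: "real^'n^'n"
  assumes "det A \<noteq> 0"
  shows "matrix_inv A $ a $ b = det (\<chi> i j. if j = a then axis b 1 $ i else A$i$j) / det A"
proof -
  have "invertible A" using assms invertible_det_nz by blast
  then have inv: "A ** matrix_inv A = mat 1"
    unfolding invertible_def matrix_inv_def by (rule someI_ex[THEN conjunct1])
  define x where "x = matrix_inv A *v axis b 1"
  have "A *v x = axis b 1"
    unfolding x_def by (simp add: matrix_vector_mul_assoc inv)
  then have "x = (\<chi> k. det (\<chi> i j. if j = k then axis b 1 $ i else A$i$j) / det A)"
    using cramer[OF assms] by blast
  moreover have "x $ a = matrix_inv A $ a $ b"
    unfolding x_def by (simp add: matrix_vector_mult_basis column_def)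
  ultimately show ?thesis by simp
qed

lemma smooth_fun_differentiable: "smooth_fun U f \<Longrightarrow> q \<in> U \<Longrightarrow> f differentiable (at q)"
  unfolding smooth_fun_def by (metis pds.simps(1))

lemma smooth_fun_pd_differentiable: "smooth_fun U f \<Longrightarrow> q \<in> U \<Longrightarrow> pd f c differentiable (at q)"
  unfolding smooth_fun_def by (metis pds.simps)

lemma smooth_covec_differentiable:
  "smooth_covec U L \<Longrightarrow> q \<in> U \<Longrightarrow> (\<lambda>p. L p a) differentiable (at q)"
  unfolding smooth_covec_def by (blast intro: smooth_fun_differentiable)

lemma smooth_tensor2_differentiable:
  "smooth_tensor2 U T \<Longrightarrow> q \<in> U \<Longrightarrow> (\<lambda>p. T p a b) differentiable (at q)"
  unfolding smooth_tensor2_def by (blast intro: smooth_fun_differentiable)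

lemma ginv_differentiable:
  fixes g :: "real^'n \<Rightarrow> 'n \<Rightarrow> 'n \<Rightarrow> real"
  assumes m: "is_metric U g" and q: "q \<in> U"
  shows "(\<lambda>p. ginv g p a b) differentiable (at q)"
proof -
  define A where "A p = ((\<chi> i j. g p i j) :: real^'n^'n)" for p
  define h where "h p = det ((\<chi> i j. if j = a then axis b 1 $ i else A p $ i $ j) :: real^'n^'n) / det (A p)"
    for p
  have g: "\<And>i j. (\<lambda>p. g p i j) differentiable (at q)"
    using m q unfolding is_metric_def by (blast intro: smooth_tensor2_differentiable)
  have entries: "(\<lambda>p. if j = a then axis b 1 $ i else A p $ i $ j) differentiable (at q)" for i j
    by (cases "j = a") (simp_all add: A_def g)
  have "(\<lambda>p. det (A p)) differentiable (at q)"
    unfolding A_def by (rule det_differentiable) (rule g)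
  moreover have "det (A q) \<noteq> 0" using m q by (simp add: is_metric_def A_def)
  ultimately have "h differentiable (at q)"
    unfolding h_def by (intro differentiable_divide det_differentiable entries)
  moreover have "h p = ginv g p a b" if "p \<in> U" for p
  proof -
    have "det (A p) \<noteq> 0" using m that by (simp add: is_metric_def A_def)
    then show ?thesis unfolding h_def ginv_def A_def[symmetric] by (simp add: matrix_inv_nth_cramer)
  qed
  moreover have "open U" using m by (simp add: is_metric_def)
  ultimately show ?thesis
    unfolding differentiable_def using q by (blast intro: has_derivative_transform_within_open)
qed

lemma Gamma_differentiable:
  assumes m: "is_metric U g" and q: "q \<in> U"
  shows "(\<lambda>p. Gamma g p a b c) differentiable (at q)"
proof -
  have gi: "\<And>d. (\<lambda>p. ginv g p a d) differentiable (at q)" using ginv_differentiable[OF m q] .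
  have pg: "\<And>x y z. pd (\<lambda>p. g p x y) z differentiable (at q)"
    using m q unfolding is_metric_def smooth_tensor2_def by (blast intro: smooth_fun_pd_differentiable)
  show ?thesis unfolding Gamma_def
    by (intro differentiable_mult differentiable_const differentiable_sum ballI differentiable_add
      differentiable_diff gi pg finite)
qed

lemma symcov1_differentiable:
  assumes m: "is_metric U g" and q: "q \<in> U" and L: "smooth_covec U L"
  shows "(\<lambda>p. symcov1 g L p a b) differentiable (at q)"
proof -
  have L0: "\<And>a. (\<lambda>p. L p a) differentiable (at q)" using smooth_covec_differentiable[OF L q] .
  have L1: "\<And>a c. pd (\<lambda>p. L p a) c differentiable (at q)"
    using L q unfolding smooth_covec_def by (blast intro: smooth_fun_pd_differentiable)
  have \<Gamma>: "\<And>x y z. (\<lambda>p. Gamma g p x y z) differentiable (at q)" using Gamma_differentiable[OF m q] .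
  show ?thesis unfolding symcov1_def cov1_def
    by (intro differentiable_divide differentiable_add differentiable_mult differentiable_sum ballI
        differentiable_diff differentiable_const \<Gamma> L0 L1 finite) auto
qed

lemma pd_chain_rule:
  fixes F :: "real^'n \<Rightarrow> real"
  assumes F: "F differentiable (at (q t))" and qd: "(q has_vector_derivative v) (at t)"
  shows "((\<lambda>s. F (q s)) has_real_derivative (\<Sum>c\<in>UNIV. pd F c (q t) * v$c)) (at t)"
proof -
  obtain F' where F': "(F has_derivative F') (at (q t))" using F unfolding differentiable_def by blast
  have lin: "linear F'" using F' has_derivative_linear by blast
  have pd: "pd F c (q t) = F' (axis c 1)" for c
  proof -
    have "((\<lambda>s. q t + s *\<^sub>R axis c 1) has_derivative (\<lambda>s. s *\<^sub>R axis c 1)) (at 0)"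
      by (auto intro!: derivative_eq_intros)
    from has_derivative_compose[OF this] F'
    have "((\<lambda>s. F (q t + s *\<^sub>R axis c 1)) has_derivative (\<lambda>s. F' (s *\<^sub>R axis c 1))) (at 0)"
      by (simp add: o_def)
    moreover have "(\<lambda>s. F' (s *\<^sub>R axis c 1)) = (\<lambda>s. F' (axis c 1) * s)"
      using lin by (simp add: linear_scale mult.commute)
    ultimately have "((\<lambda>s. F (q t + s *\<^sub>R axis c 1)) has_real_derivative F' (axis c 1)) (at 0)"
      by (simp add: has_field_derivative_def)
    then show ?thesis unfolding pd_def by (rule DERIV_imp_deriv)
  qed
  have "(q has_derivative (\<lambda>s. s *\<^sub>R v)) (at t)" using qd by (simp add: has_vector_derivative_def)
  from has_derivative_compose[OF this F']
  have "((\<lambda>s. F (q s)) has_derivative (\<lambda>s. F' (s *\<^sub>R v))) (at t)" by (simp add: o_def)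
  moreover have "F' v = (\<Sum>c\<in>UNIV. pd F c (q t) * v$c)"
  proof -
    have "F' v = F' (\<Sum>c\<in>UNIV. v$c *\<^sub>R axis c 1)"
      using basis_expansion[of v] by (simp add: scalar_mult_eq_scaleR)
    also have "\<dots> = (\<Sum>c\<in>UNIV. v$c * F' (axis c 1))"
      using lin by (simp add: linear_sum linear_scale)
    finally show ?thesis by (simp add: pd mult.commute)
  qed
  moreover have "(\<lambda>s. F' (s *\<^sub>R v)) = (\<lambda>s. F' v * s)"
    using lin by (simp add: linear_scale mult.commute)
  ultimately show ?thesis
    by (simp add: has_field_derivative_def)
qed

lemma has_real_derivative_vec_nth:
  assumes "(v has_vector_derivative w) (at t)"
  shows "((\<lambda>s. v s $ a) has_real_derivative w $ a) (at t)"
proof -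
  have "(v has_derivative (\<lambda>x. x *\<^sub>R w)) (at t)" using assms by (simp add: has_vector_derivative_def)
  from bounded_linear.has_derivative[OF bounded_linear_vec_nth this]
  have "((\<lambda>s. v s $ a) has_derivative (\<lambda>x. (x *\<^sub>R w) $ a)) (at t)" .
  moreover have "(\<lambda>x. (x *\<^sub>R w) $ a) = (\<lambda>x. w $ a * x)" by (auto simp: mult.commute)
  ultimately show ?thesis by (simp add: has_field_derivative_def)
qed

subsection \<open>Contractions with the velocity\<close>

lemma sum_rotate3: "(\<Sum>a\<in>A. \<Sum>b\<in>B. \<Sum>c\<in>C. f a b c) = (\<Sum>b\<in>B. \<Sum>c\<in>C. \<Sum>a\<in>A. f a b c)"
proof -
  have "(\<Sum>a\<in>A. \<Sum>b\<in>B. \<Sum>c\<in>C. f a b c) = (\<Sum>b\<in>B. \<Sum>a\<in>A. \<Sum>c\<in>C. f a b c)" by (rule sum.swap)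
  also have "\<dots> = (\<Sum>b\<in>B. \<Sum>c\<in>C. \<Sum>a\<in>A. f a b c)" by (rule sum.cong[OF refl], rule sum.swap)
  finally show ?thesis .
qed

lemma sum_rotate4: "(\<Sum>a\<in>A. \<Sum>b\<in>B. \<Sum>d\<in>D. \<Sum>c\<in>C. f a b d c) = (\<Sum>d\<in>D. \<Sum>b\<in>B. \<Sum>c\<in>C. \<Sum>a\<in>A. f a b d c)"
proof -
  have "(\<Sum>a\<in>A. \<Sum>b\<in>B. \<Sum>d\<in>D. \<Sum>c\<in>C. f a b d c) = (\<Sum>b\<in>B. \<Sum>a\<in>A. \<Sum>d\<in>D. \<Sum>c\<in>C. f a b d c)" by (rule sum.swap)
  also have "\<dots> = (\<Sum>b\<in>B. \<Sum>d\<in>D. \<Sum>a\<in>A. \<Sum>c\<in>C. f a b d c)" by (rule sum.cong[OF refl], rule sum.swap)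
  also have "\<dots> = (\<Sum>b\<in>B. \<Sum>d\<in>D. \<Sum>c\<in>C. \<Sum>a\<in>A. f a b d c)" by (rule sum.cong[OF refl], rule sum.cong[OF refl], rule sum.swap)
  also have "\<dots> = (\<Sum>d\<in>D. \<Sum>b\<in>B. \<Sum>c\<in>C. \<Sum>a\<in>A. f a b d c)" by (rule sum.swap)
  finally show ?thesis .
qed

lemma sym3_contraction:
  fixes W :: "'n::finite \<Rightarrow> 'n \<Rightarrow> 'n \<Rightarrow> real"
  shows "(\<Sum>a\<in>UNIV. \<Sum>b\<in>UNIV. \<Sum>c\<in>UNIV. sym3 W a b c * x$a * x$b * x$c)
       = (\<Sum>a\<in>UNIV. \<Sum>b\<in>UNIV. \<Sum>c\<in>UNIV. W a b c * x$a * x$b * x$c)"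
proof -
  define S where "S W' = (\<Sum>a\<in>UNIV. \<Sum>b\<in>UNIV. \<Sum>c\<in>UNIV. W' a b c * x$a * x$b * x$c)" for W' :: "'n \<Rightarrow> 'n \<Rightarrow> 'n \<Rightarrow> real"
  have swbc: "S (\<lambda>a b c. W' a c b) = S W'" for W'
    unfolding S_def by (rule sum.cong[OF refl], subst sum.swap) (simp add: ac_simps)
  have swab: "S (\<lambda>a b c. W' b a c) = S W'" for W'
    unfolding S_def by (subst sum.swap) (simp add: ac_simps)
  have lhs: "(\<Sum>a\<in>UNIV. \<Sum>b\<in>UNIV. \<Sum>c\<in>UNIV. sym3 W a b c * x$a * x$b * x$c)
     = (S (\<lambda>a b c. W a b c) + S (\<lambda>a b c. W a c b) + S (\<lambda>a b c. W b a c) + S (\<lambda>a b c. W b c a)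
        + S (\<lambda>a b c. W c a b) + S (\<lambda>a b c. W c b a)) / 6"
    unfolding S_def sym3_def by (simp add: sum.distrib sum_divide_distrib[symmetric] algebra_simps add_divide_distrib)
  have e1: "S (\<lambda>a b c. W a c b) = S W" by (rule swbc)
  have e2: "S (\<lambda>a b c. W b a c) = S W" by (rule swab)
  have e3: "S (\<lambda>a b c. W b c a) = S W"
    using swab[of "\<lambda>a b c. W a c b"] swbc[of W] by simp
  have e4: "S (\<lambda>a b c. W c a b) = S W"
    using swbc[of "\<lambda>a b c. W b a c"] swab[of W] by simp
  have e5: "S (\<lambda>a b c. W c b a) = S W"
    using swab[of "\<lambda>a b c. W c a b"] e4 by simp
  show ?thesis using lhs e1 e2 e3 e4 e5 by (simp add: S_def)
qed

lemma is_CKT_contraction: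
  assumes "is_CKT U g T u" "q \<in> U"
  shows "(\<Sum>a\<in>UNIV. \<Sum>b\<in>UNIV. \<Sum>c\<in>UNIV. cov2 g T q a b c * x$a * x$b * x$c)
       = contract1 u q x * contract2 g q x"
proof -
  have "(\<Sum>a\<in>UNIV. \<Sum>b\<in>UNIV. \<Sum>c\<in>UNIV. cov2 g T q a b c * x$a * x$b * x$c)
     = (\<Sum>a\<in>UNIV. \<Sum>b\<in>UNIV. \<Sum>c\<in>UNIV. sym3 (cov2 g T q) a b c * x$a * x$b * x$c)"
    by (rule sym3_contraction[symmetric])
  also have "\<dots> = (\<Sum>a\<in>UNIV. \<Sum>b\<in>UNIV. \<Sum>c\<in>UNIV. sym3 (\<lambda>x y z. u q x * g q y z) a b c * x$a * x$b * x$c)"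
    using assms unfolding is_CKT_def by simp
  also have "\<dots> = (\<Sum>a\<in>UNIV. \<Sum>b\<in>UNIV. \<Sum>c\<in>UNIV. u q a * g q b c * x$a * x$b * x$c)"
    by (rule sym3_contraction)
  also have "\<dots> = contract1 u q x * contract2 g q x"
    unfolding contract1_def contract2_def
    by (simp add: sum_distrib_right) (simp add: sum_distrib_left ac_simps)
  finally show ?thesis .
qed

lemma contract2_symcov1:
  "contract2 (symcov1 g L) q x = (\<Sum>a\<in>UNIV. \<Sum>b\<in>UNIV. cov1 g L q a b * x$a * x$b)"
proof -
  have "(\<Sum>a\<in>UNIV. \<Sum>b\<in>UNIV. cov1 g L q b a * x$a * x$b) = (\<Sum>a\<in>UNIV. \<Sum>b\<in>UNIV. cov1 g L q a b * x$a * x$b)"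
    by (subst sum.swap) (simp add: ac_simps)
  then show ?thesis
    unfolding contract2_def symcov1_def
    by (simp add: sum.distrib add_divide_distrib distrib_right sum_divide_distrib[symmetric])
qed

lemma contract1_eq_scaled:
  assumes "\<And>a. c * L q a = d * M q a"
  shows "c * contract1 L q x = d * contract1 M q x"
  unfolding contract1_def by (simp add: sum_distrib_left mult.assoc[symmetric] assms)

lemma quadratic_form_combination:
  fixes M :: "'k \<Rightarrow> 'n::finite \<Rightarrow> 'n \<Rightarrow> real" and C :: "'n \<Rightarrow> 'n \<Rightarrow> real" and x :: "real^'n"
  shows "(\<Sum>a\<in>UNIV. \<Sum>b\<in>UNIV. (- (\<Sum>k\<in>K. c k * M k a b) + C a b) * x$a * x$b)
    = - (\<Sum>k\<in>K. c k * (\<Sum>a\<in>UNIV. \<Sum>b\<in>UNIV. M k a b * x$a * x$b))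
      + (\<Sum>a\<in>UNIV. \<Sum>b\<in>UNIV. C a b * x$a * x$b)"
proof -
  have "(- (\<Sum>k\<in>K. c k * M k a b) + C a b) * x$a * x$b
      = C a b * x$a * x$b - (\<Sum>k\<in>K. c k * M k a b * x$a * x$b)" for a b
    by (simp add: algebra_simps sum_distrib_right sum_distrib_left)
  then have "(\<Sum>a\<in>UNIV. \<Sum>b\<in>UNIV. (- (\<Sum>k\<in>K. c k * M k a b) + C a b) * x$a * x$b)
     = (\<Sum>a\<in>UNIV. \<Sum>b\<in>UNIV. C a b * x$a * x$b) - (\<Sum>a\<in>UNIV. \<Sum>b\<in>UNIV. \<Sum>k\<in>K. c k * M k a b * x$a * x$b)"
    by (simp only: sum_subtractf)
  also have "(\<Sum>a\<in>UNIV. \<Sum>b\<in>UNIV. \<Sum>k\<in>K. c k * M k a b * x$a * x$b)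
      = (\<Sum>k\<in>K. \<Sum>a\<in>UNIV. \<Sum>b\<in>UNIV. c k * M k a b * x$a * x$b)"
    by (rule sum_rotate3[symmetric])
  also have "\<dots> = (\<Sum>k\<in>K. c k * (\<Sum>a\<in>UNIV. \<Sum>b\<in>UNIV. M k a b * x$a * x$b))"
    by (simp add: sum_distrib_left mult.assoc)
  finally show ?thesis by simp
qed

lemma sum_regroup:
  fixes a b :: "'k \<Rightarrow> 'a::ab_group_add"
  shows "- sum a K + B + sum b K + G = (\<Sum>k\<in>K. - a k + b k) + B + G"
  by (simp only: sum.distrib sum_negf) (simp add: algebra_simps)

lemma linear_form_geodesic_identity:
  fixes P :: "'n::finite \<Rightarrow> 'n \<Rightarrow> real" and L :: "'n \<Rightarrow> real" and Gm :: "'n \<Rightarrow> 'n \<Rightarrow> 'n \<Rightarrow> real"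
    and x :: "real^'n" and acc :: "'n \<Rightarrow> real"
  assumes acc: "\<And>a. acc a = - (\<Sum>b\<in>UNIV. \<Sum>c\<in>UNIV. Gm a b c * x$b * x$c)"
  shows "(\<Sum>a\<in>UNIV. L a * acc a + (\<Sum>c\<in>UNIV. P a c * x$c) * x$a)
       = (\<Sum>a\<in>UNIV. \<Sum>b\<in>UNIV. (P a b - (\<Sum>c\<in>UNIV. Gm c a b * L c)) * x$a * x$b)"
proof -
  have "(\<Sum>a\<in>UNIV. L a * acc a) = - (\<Sum>a\<in>UNIV. \<Sum>b\<in>UNIV. \<Sum>c\<in>UNIV. L a * Gm a b c * x$b * x$c)"
    by (simp add: acc sum_distrib_left sum_negf mult.assoc)
  also have "\<dots> = - (\<Sum>b\<in>UNIV. \<Sum>c\<in>UNIV. \<Sum>a\<in>UNIV. L a * Gm a b c * x$b * x$c)"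
    by (rule arg_cong[where f=uminus], rule sum_rotate3)
  also have "\<dots> = - (\<Sum>a\<in>UNIV. \<Sum>b\<in>UNIV. (\<Sum>c\<in>UNIV. Gm c a b * L c) * x$a * x$b)"
    by (simp add: sum_distrib_left sum_distrib_right mult_ac)
  finally have h1: "(\<Sum>a\<in>UNIV. L a * acc a) = - (\<Sum>a\<in>UNIV. \<Sum>b\<in>UNIV. (\<Sum>c\<in>UNIV. Gm c a b * L c) * x$a * x$b)" .
  have h2: "(\<Sum>a\<in>UNIV. (\<Sum>c\<in>UNIV. P a c * x$c) * x$a) = (\<Sum>a\<in>UNIV. \<Sum>b\<in>UNIV. P a b * x$a * x$b)"
    by (simp add: sum_distrib_left sum_distrib_right mult_ac)
  have h3: "(\<Sum>a\<in>UNIV. \<Sum>b\<in>UNIV. (P a b - (\<Sum>c\<in>UNIV. Gm c a b * L c)) * x$a * x$b)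
     = (\<Sum>a\<in>UNIV. \<Sum>b\<in>UNIV. P a b * x$a * x$b) - (\<Sum>a\<in>UNIV. \<Sum>b\<in>UNIV. (\<Sum>c\<in>UNIV. Gm c a b * L c) * x$a * x$b)"
    by (simp add: left_diff_distrib sum_subtractf)
  show ?thesis using h1 h2 h3 by (simp add: sum.distrib)
qed

lemma quadratic_form_geodesic_identity:
  fixes P :: "'n::finite \<Rightarrow> 'n \<Rightarrow> 'n \<Rightarrow> real" and Tq :: "'n \<Rightarrow> 'n \<Rightarrow> real" and Gm :: "'n \<Rightarrow> 'n \<Rightarrow> 'n \<Rightarrow> real"
    and x :: "real^'n" and acc :: "'n \<Rightarrow> real"
  assumes acc: "\<And>a. acc a = - (\<Sum>b\<in>UNIV. \<Sum>c\<in>UNIV. Gm a b c * x$b * x$c)"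
  shows "(\<Sum>a\<in>UNIV. \<Sum>b\<in>UNIV. Tq a b * x$a * acc b + (Tq a b * acc a + (\<Sum>c\<in>UNIV. P a b c * x$c) * x$a) * x$b)
       = (\<Sum>a\<in>UNIV. \<Sum>b\<in>UNIV. \<Sum>c\<in>UNIV. (P a b c - (\<Sum>d\<in>UNIV. Gm d a c * Tq d b) - (\<Sum>d\<in>UNIV. Gm d b c * Tq a d)) * x$a * x$b * x$c)"
proof -
  have EP: "(\<Sum>a\<in>UNIV. \<Sum>b\<in>UNIV. (\<Sum>c\<in>UNIV. P a b c * x$c) * x$a * x$b) = (\<Sum>a\<in>UNIV. \<Sum>b\<in>UNIV. \<Sum>c\<in>UNIV. P a b c * x$a * x$b * x$c)"
    by (simp add: sum_distrib_left sum_distrib_right mult_ac)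
  have "(\<Sum>a\<in>UNIV. \<Sum>b\<in>UNIV. Tq a b * x$a * acc b) = - (\<Sum>a\<in>UNIV. \<Sum>b\<in>UNIV. \<Sum>d\<in>UNIV. \<Sum>c\<in>UNIV. Tq a b * x$a * Gm b d c * x$d * x$c)"
    by (simp add: acc sum_distrib_left sum_negf mult.assoc)
  also have "\<dots> = - (\<Sum>a\<in>UNIV. \<Sum>d\<in>UNIV. \<Sum>c\<in>UNIV. \<Sum>b\<in>UNIV. Tq a b * x$a * Gm b d c * x$d * x$c)"
    by (rule arg_cong[where f=uminus], rule sum.cong[OF refl], rule sum_rotate3)
  also have "\<dots> = - (\<Sum>a\<in>UNIV. \<Sum>b\<in>UNIV. \<Sum>c\<in>UNIV. (\<Sum>d\<in>UNIV. Gm d b c * Tq a d) * x$a * x$b * x$c)"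
    by (simp add: sum_distrib_left sum_distrib_right mult_ac)
  finally have E1: "(\<Sum>a\<in>UNIV. \<Sum>b\<in>UNIV. Tq a b * x$a * acc b) = - (\<Sum>a\<in>UNIV. \<Sum>b\<in>UNIV. \<Sum>c\<in>UNIV. (\<Sum>d\<in>UNIV. Gm d b c * Tq a d) * x$a * x$b * x$c)" .
  have "(\<Sum>a\<in>UNIV. \<Sum>b\<in>UNIV. Tq a b * acc a * x$b) = - (\<Sum>a\<in>UNIV. \<Sum>b\<in>UNIV. \<Sum>d\<in>UNIV. \<Sum>c\<in>UNIV. Tq a b * Gm a d c * x$d * x$c * x$b)"
    by (simp add: acc sum_distrib_left sum_distrib_right sum_negf mult.assoc)
  also have "\<dots> = - (\<Sum>d\<in>UNIV. \<Sum>b\<in>UNIV. \<Sum>c\<in>UNIV. \<Sum>a\<in>UNIV. Tq a b * Gm a d c * x$d * x$c * x$b)"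
    by (rule arg_cong[where f=uminus], rule sum_rotate4)
  also have "\<dots> = - (\<Sum>a\<in>UNIV. \<Sum>b\<in>UNIV. \<Sum>c\<in>UNIV. (\<Sum>d\<in>UNIV. Gm d a c * Tq d b) * x$a * x$b * x$c)"
    by (simp add: sum_distrib_left sum_distrib_right mult_ac)
  finally have E2: "(\<Sum>a\<in>UNIV. \<Sum>b\<in>UNIV. Tq a b * acc a * x$b) = - (\<Sum>a\<in>UNIV. \<Sum>b\<in>UNIV. \<Sum>c\<in>UNIV. (\<Sum>d\<in>UNIV. Gm d a c * Tq d b) * x$a * x$b * x$c)" .
  have L: "(\<Sum>a\<in>UNIV. \<Sum>b\<in>UNIV. Tq a b * x$a * acc b + (Tq a b * acc a + (\<Sum>c\<in>UNIV. P a b c * x$c) * x$a) * x$b)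
     = (\<Sum>a\<in>UNIV. \<Sum>b\<in>UNIV. Tq a b * x$a * acc b) + (\<Sum>a\<in>UNIV. \<Sum>b\<in>UNIV. Tq a b * acc a * x$b)
       + (\<Sum>a\<in>UNIV. \<Sum>b\<in>UNIV. (\<Sum>c\<in>UNIV. P a b c * x$c) * x$a * x$b)"
    by (simp add: sum.distrib distrib_right)
  have R: "(\<Sum>a\<in>UNIV. \<Sum>b\<in>UNIV. \<Sum>c\<in>UNIV. (P a b c - (\<Sum>d\<in>UNIV. Gm d a c * Tq d b) - (\<Sum>d\<in>UNIV. Gm d b c * Tq a d)) * x$a * x$b * x$c)
     = (\<Sum>a\<in>UNIV. \<Sum>b\<in>UNIV. \<Sum>c\<in>UNIV. P a b c * x$a * x$b * x$c)
       - (\<Sum>a\<in>UNIV. \<Sum>b\<in>UNIV. \<Sum>c\<in>UNIV. (\<Sum>d\<in>UNIV. Gm d a c * Tq d b) * x$a * x$b * x$c)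
       - (\<Sum>a\<in>UNIV. \<Sum>b\<in>UNIV. \<Sum>c\<in>UNIV. (\<Sum>d\<in>UNIV. Gm d b c * Tq a d) * x$a * x$b * x$c)"
    by (simp only: left_diff_distrib sum_subtractf)
  show ?thesis unfolding L R E1 E2 EP by simp
qed

subsection \<open>Polynomial weights in time\<close>

text \<open>Since \<open>P' = S\<close>, the two \<open>S\<close>-terms produced by differentiating the powers cancel.\<close>

lemma power_pair_has_derivative:
  assumes m: "1 \<le> m" and dS: "(S has_real_derivative S') (at t)" and dP: "(P has_real_derivative S t) (at t)"
  shows "((\<lambda>s. - (s^m / real m) * S s + s^(m-1) * P s) has_real_derivative
           - (t^m / real m) * S' + real (m-1) * t^(m-2) * P t) (at t)"
proof (rule DERIV_cong[OF DERIV_add[OF DERIV_mult'[OF DERIV_minus[OF DERIV_cdivide[OF DERIV_pow]] dS]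
      DERIV_mult'[OF DERIV_pow dP]]])
  show "- (t^m / real m) * S' + - (real m * t^(m - Suc 0) / real m) * S t
      + (t^(m-1) * S t + real (m-1) * t^(m - 1 - Suc 0) * P t)
      = - (t^m / real m) * S' + real (m-1) * t^(m-2) * P t"
    using m by (simp add: diff_diff_add numeral_2_eq_2)
qed

text \<open>By the recursion, the \<open>k\<close>-th term involving \<open>A\<close> cancels the \<open>(k+1)\<close>-st term involving
  \<open>P\<close>, and the top term involving \<open>A\<close> vanishes.\<close>

lemma telescope_even_series:
  fixes A P :: "nat \<Rightarrow> real"
  assumes top: "E0 * A l = 0"
    and step: "\<And>k. k < l \<Longrightarrow> E0 * A k = (real k + 1) * (2 * real k + 1) * P (k + 1)"
  shows "(\<Sum>k=0..l. - (t^(2*k+1) / (2 * real k + 1)) * (2 * E0 * A k) + real (2*k) * t^(2*k-1) * P k) = 0"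
proof -
  have "(\<Sum>k=0..l. - (t^(2*k+1) / (2 * real k + 1)) * (2 * E0 * A k))
      = (\<Sum>k<l. - (t^(2*k+1) / (2 * real k + 1)) * (2 * E0 * A k))"
    using top by (simp add: atLeast0AtMost lessThan_Suc_atMost[symmetric])
  also have "\<dots> = - (\<Sum>k<l. 2 * (real k + 1) * t^(2*k+1) * P (k+1))"
  proof -
    have "- (t^(2*k+1) / (2 * real k + 1)) * (2 * E0 * A k) = - (2 * (real k + 1) * t^(2*k+1) * P (k+1))"
      if "k < l" for k
    proof -
      have "2 * E0 * A k = 2 * ((real k + 1) * (2 * real k + 1) * P (k + 1))"
        by (simp add: step[OF that])
      then show ?thesis by (simp add: field_simps)
    qed
    then show ?thesis by (simp add: sum_negf[symmetric])
  qed
  also have "(\<Sum>k<l. 2 * (real k + 1) * t^(2*k+1) * P (k+1)) = (\<Sum>k=0..l. real (2*k) * t^(2*k-1) * P k)"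
    by (simp add: atLeast0AtMost lessThan_Suc_atMost[symmetric] sum.lessThan_Suc_shift algebra_simps del: sum.lessThan_Suc)
  finally show ?thesis by (simp only: sum.distrib)
qed

lemma telescope_odd_series:
  fixes A P :: "nat \<Rightarrow> real"
  assumes top: "l \<ge> 1 \<Longrightarrow> E0 * A l = 0"
    and step: "\<And>k. k \<in> {1..<l} \<Longrightarrow> E0 * A k = real k * (2 * real k + 1) * P (k + 1)"
  shows "(\<Sum>k=1..l. - (t^(2*k) / (2 * real k)) * (2 * E0 * A k) + real (2*k-1) * t^(2*k-2) * P k)
       = (if l > 0 then P 1 else 0)"
proof (cases l)
  case 0
  then show ?thesis by simp
next
  case (Suc m)
  define f where "f k = - (t^(2*k) / (2 * real k)) * (2 * E0 * A k)" for k
  have "(\<Sum>k=1..l. f k) = (\<Sum>j<m. f (Suc j)) + f (Suc m)"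
    unfolding Suc by (simp only: One_nat_def sum.atLeast1_atMost_eq sum.lessThan_Suc)
  also have "f (Suc m) = 0"
    using top Suc by (simp add: f_def)
  also have "(\<Sum>j<m. f (Suc j)) = - (\<Sum>j<m. (2 * real j + 3) * t^(2*j+2) * P (j+2))"
  proof -
    have "f (Suc j) = - ((2 * real j + 3) * t^(2*j+2) * P (j+2))" if "j < m" for j
    proof -
      have "2 * E0 * A (Suc j) = 2 * (real (Suc j) * (2 * real (Suc j) + 1) * P (j + 2))"
        using step[of "Suc j"] that Suc by simp
      then show ?thesis by (simp add: f_def field_simps)
    qed
    then show ?thesis by (simp add: sum_negf[symmetric])
  qed
  finally have lower: "(\<Sum>k=1..l. f k) = - (\<Sum>j<m. (2 * real j + 3) * t^(2*j+2) * P (j+2))"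
    by simp
  have upper: "(\<Sum>k=1..l. real (2*k-1) * t^(2*k-2) * P k) = P 1 + (\<Sum>j<m. (2 * real j + 3) * t^(2*j+2) * P (j+2))"
    unfolding Suc by (simp only: One_nat_def sum.atLeast1_atMost_eq sum.lessThan_Suc_shift) (simp add: algebra_simps)
  have "(\<Sum>k=1..l. - (t^(2*k) / (2 * real k)) * (2 * E0 * A k) + real (2*k-1) * t^(2*k-2) * P k)
      = (\<Sum>k=1..l. f k) + (\<Sum>k=1..l. real (2*k-1) * t^(2*k-2) * P k)"
    by (simp only: f_def sum.distrib)
  then show ?thesis using Suc lower upper by simp
qed

subsection \<open>Differentiation along a geodesic\<close>

text \<open>\<open>v\<close> is the velocity along the whole curve, \<open>acc\<close> its derivative at the single time \<open>t\<close>.\<close>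

locale geodesic_at =
  fixes g :: "real^'n \<Rightarrow> 'n \<Rightarrow> 'n \<Rightarrow> real" and q v :: "real \<Rightarrow> real^'n"
    and acc :: "real^'n" and t :: real
  assumes velocity: "(q has_vector_derivative v t) (at t)"
    and acceleration: "(v has_vector_derivative acc) (at t)"
    and geodesic_eq: "\<And>a. acc $ a + (\<Sum>b\<in>UNIV. \<Sum>c\<in>UNIV. Gamma g (q t) a b c * v t $ b * v t $ c) = 0"
begin

lemma acc_eq: "acc $ a = - (\<Sum>b\<in>UNIV. \<Sum>c\<in>UNIV. Gamma g (q t) a b c * v t $ b * v t $ c)"
  using geodesic_eq by (simp add: eq_neg_iff_add_eq_0)

lemma contract1_has_derivative:
  assumes L: "\<And>a. (\<lambda>p. L p a) differentiable (at (q t))"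
  shows "((\<lambda>s. contract1 L (q s) (v s)) has_real_derivative contract2 (symcov1 g L) (q t) (v t)) (at t)"
proof -
  have "((\<lambda>s. contract1 L (q s) (v s)) has_real_derivative
      (\<Sum>a\<in>UNIV. L (q t) a * acc $ a + (\<Sum>c\<in>UNIV. pd (\<lambda>p. L p a) c (q t) * v t $ c) * v t $ a)) (at t)"
    unfolding contract1_def
    by (intro DERIV_sum) (rule DERIV_mult'[OF pd_chain_rule[OF L velocity] has_real_derivative_vec_nth[OF acceleration]])
  moreover have "(\<Sum>a\<in>UNIV. L (q t) a * acc $ a + (\<Sum>c\<in>UNIV. pd (\<lambda>p. L p a) c (q t) * v t $ c) * v t $ a)
      = contract2 (symcov1 g L) (q t) (v t)"
    unfolding contract2_symcov1 cov1_def
    by (rule linear_form_geodesic_identity[where acc="\<lambda>a. acc $ a", OF acc_eq])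
  ultimately show ?thesis by simp
qed

lemma contract2_has_derivative:
  assumes T: "\<And>a b. (\<lambda>p. T p a b) differentiable (at (q t))"
  shows "((\<lambda>s. contract2 T (q s) (v s)) has_real_derivative
           (\<Sum>a\<in>UNIV. \<Sum>b\<in>UNIV. \<Sum>c\<in>UNIV. cov2 g T (q t) a b c * v t $ a * v t $ b * v t $ c)) (at t)"
proof -
  have vc: "\<And>a. ((\<lambda>s. v s $ a) has_real_derivative acc $ a) (at t)"
    using has_real_derivative_vec_nth[OF acceleration] .
  have "((\<lambda>s. contract2 T (q s) (v s)) has_real_derivative
      (\<Sum>a\<in>UNIV. \<Sum>b\<in>UNIV. T (q t) a b * v t $ a * acc $ b
        + (T (q t) a b * acc $ a + (\<Sum>c\<in>UNIV. pd (\<lambda>p. T p a b) c (q t) * v t $ c) * v t $ a) * v t $ b)) (at t)"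
    unfolding contract2_def
    by (intro DERIV_sum) (rule DERIV_mult'[OF DERIV_mult'[OF pd_chain_rule[OF T velocity] vc] vc])
  moreover have "(\<Sum>a\<in>UNIV. \<Sum>b\<in>UNIV. T (q t) a b * v t $ a * acc $ b
        + (T (q t) a b * acc $ a + (\<Sum>c\<in>UNIV. pd (\<lambda>p. T p a b) c (q t) * v t $ c) * v t $ a) * v t $ b)
      = (\<Sum>a\<in>UNIV. \<Sum>b\<in>UNIV. \<Sum>c\<in>UNIV. cov2 g T (q t) a b c * v t $ a * v t $ b * v t $ c)"
    unfolding cov2_def
    by (rule quadratic_form_geodesic_identity[where acc="\<lambda>a. acc $ a", OF acc_eq])
  ultimately show ?thesis by simp
qed

end

locale constrained_geodesic_at = geodesic_at +
  fixes U :: "(real^'n) set" and E0 :: real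
  assumes metric: "is_metric U g" and in_domain: "q t \<in> U"
    and energy: "contract2 g (q t) (v t) = 2 * E0"
begin

text \<open>On the energy shell the conformal factor \<open>\<gamma>(q', q')\<close> is the constant \<open>2 E0\<close>.\<close>

lemma CKT_contract2_has_derivative:
  assumes "\<And>a b. (\<lambda>p. T p a b) differentiable (at (q t))" and "is_CKT U g T u"
  shows "((\<lambda>s. contract2 T (q s) (v s)) has_real_derivative 2 * E0 * contract1 u (q t) (v t)) (at t)"
proof -
  have "((\<lambda>s. contract2 T (q s) (v s)) has_real_derivative
      (\<Sum>a\<in>UNIV. \<Sum>b\<in>UNIV. \<Sum>c\<in>UNIV. cov2 g T (q t) a b c * v t $ a * v t $ b * v t $ c)) (at t)"
    by (rule contract2_has_derivative) (rule assms(1))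
  then show ?thesis
    using is_CKT_contraction[OF assms(2) in_domain, of "v t"] energy by (simp add: mult.commute)
qed

lemma symcov1_contract2_has_derivative:
  assumes "smooth_covec U L" and "is_CKT U g (symcov1 g L) Y"
  shows "((\<lambda>s. contract2 (symcov1 g L) (q s) (v s)) has_real_derivative
           2 * E0 * contract1 Y (q t) (v t)) (at t)"
  using CKT_contract2_has_derivative[OF symcov1_differentiable[OF metric in_domain assms(1)] assms(2)] .

lemma smooth_covec_contract1_has_derivative:
  assumes "smooth_covec U L"
  shows "((\<lambda>s. contract1 L (q s) (v s)) has_real_derivative contract2 (symcov1 g L) (q t) (v t)) (at t)"
  using contract1_has_derivative[OF smooth_covec_differentiable[OF assms in_domain]] .

lemma exponential_integral_has_derivative_zero:
  assumes lam: "lam \<noteq> 0" and L: "smooth_covec U L" and CKT: "is_CKT U g (symcov1 g L) Y"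
    and LY: "\<And>a. L (q t) a = 2 * E0 / lam^2 * Y (q t) a"
  shows "((\<lambda>s. exp (lam * s) *
            (- contract2 (symcov1 g L) (q s) (v s) + lam * contract1 L (q s) (v s))) has_real_derivative 0) (at t)"
proof -
  define S where "S s = contract2 (symcov1 g L) (q s) (v s)" for s
  define P where "P s = contract1 L (q s) (v s)" for s
  define A where "A = contract1 Y (q t) (v t)"
  have dS: "(S has_real_derivative 2 * E0 * A) (at t)"
    unfolding S_def A_def by (rule symcov1_contract2_has_derivative[OF L CKT])
  have dP: "(P has_real_derivative S t) (at t)"
    unfolding S_def P_def by (rule smooth_covec_contract1_has_derivative[OF L])
  have dE: "((\<lambda>s. exp (lam * s)) has_real_derivative exp (lam * t) * lam) (at t)"
    by (auto intro!: derivative_eq_intros)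
  have PA: "P t = 2 * E0 / lam^2 * A"
    using contract1_eq_scaled[of 1 L "q t" "2 * E0 / lam^2" Y "v t"] LY by (simp add: P_def A_def)
  have "((\<lambda>s. exp (lam * s) * (- S s + lam * P s)) has_real_derivative
      exp (lam * t) * (- (2 * E0 * A) + lam * S t) + exp (lam * t) * lam * (- S t + lam * P t)) (at t)"
    by (rule DERIV_mult'[OF dE DERIV_add[OF DERIV_minus[OF dS] DERIV_cmult[OF dP]]])
  moreover have "exp (lam * t) * (- (2 * E0 * A) + lam * S t) + exp (lam * t) * lam * (- S t + lam * P t) = 0"
    using lam unfolding PA by (simp add: field_simps power2_eq_square)
  ultimately show ?thesis unfolding S_def P_def by simp
qed

lemma even_series_integral_has_derivative_zero:
  assumes L: "\<And>k. k \<le> l \<Longrightarrow> smooth_covec U (L (2*k))"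
    and CKT: "\<And>k. k \<le> l \<Longrightarrow> is_CKT U g (symcov1 g (L (2*k))) (Y (2*k))"
    and top: "\<And>a. E0 * Y (2*l) (q t) a = 0"
    and step: "\<And>k a. k < l \<Longrightarrow> E0 * Y (2*k) (q t) a = (real k + 1) * (2 * real k + 1) * L (2*k+2) (q t) a"
  shows "((\<lambda>s. \<Sum>k=0..l. - (s^(2*k+1) / (2 * real k + 1)) * contract2 (symcov1 g (L (2*k))) (q s) (v s)
                        + s^(2*k) * contract1 (L (2*k)) (q s) (v s)) has_real_derivative 0) (at t)"
proof -
  define S where "S k s = contract2 (symcov1 g (L (2*k))) (q s) (v s)" for k s
  define P where "P k s = contract1 (L (2*k)) (q s) (v s)" for k s
  define A where "A k = contract1 (Y (2*k)) (q t) (v t)" for k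
  have "((\<lambda>s. \<Sum>k=0..l. - (s^(2*k+1) / (2 * real k + 1)) * S k s + s^(2*k) * P k s) has_real_derivative
      (\<Sum>k=0..l. - (t^(2*k+1) / (2 * real k + 1)) * (2 * E0 * A k) + real (2*k) * t^(2*k-1) * P k t)) (at t)"
  proof (rule DERIV_sum)
    fix k assume "k \<in> {0..l}"
    then have Lk: "smooth_covec U (L (2*k))" and CKTk: "is_CKT U g (symcov1 g (L (2*k))) (Y (2*k))"
      using L CKT by auto
    have "(S k has_real_derivative 2 * E0 * A k) (at t)" and "(P k has_real_derivative S k t) (at t)"
      unfolding S_def P_def A_def
      by (rule symcov1_contract2_has_derivative[OF Lk CKTk], rule smooth_covec_contract1_has_derivative[OF Lk])
    from power_pair_has_derivative[of "2*k+1", OF _ this]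
    show "((\<lambda>s. - (s^(2*k+1) / (2 * real k + 1)) * S k s + s^(2*k) * P k s) has_real_derivative
        - (t^(2*k+1) / (2 * real k + 1)) * (2 * E0 * A k) + real (2*k) * t^(2*k-1) * P k t) (at t)"
      by (simp add: add.commute)
  qed
  moreover have "(\<Sum>k=0..l. - (t^(2*k+1) / (2 * real k + 1)) * (2 * E0 * A k) + real (2*k) * t^(2*k-1) * P k t) = 0"
  proof (rule telescope_even_series)
    show "E0 * A l = 0"
      using contract1_eq_scaled[of E0 "Y (2*l)" "q t" 0 "Y (2*l)" "v t"] top by (simp add: A_def)
    show "E0 * A k = (real k + 1) * (2 * real k + 1) * P (k + 1) t" if "k < l" for k
      using contract1_eq_scaled[of E0 "Y (2*k)" "q t" _ "L (2*k+2)" "v t"] step[OF that]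
      by (simp add: A_def P_def)
  qed
  ultimately show ?thesis unfolding S_def P_def by simp
qed

lemma odd_series_has_derivative:
  assumes L: "\<And>k. k \<in> {1..l} \<Longrightarrow> smooth_covec U (L (2*k-1))"
    and CKT: "\<And>k. k \<in> {1..l} \<Longrightarrow> is_CKT U g (symcov1 g (L (2*k-1))) (Y (2*k-1))"
    and top: "\<And>a. l \<ge> 1 \<Longrightarrow> E0 * Y (2*l-1) (q t) a = 0"
    and step: "\<And>k a. k \<in> {1..<l} \<Longrightarrow>
                 E0 * Y (2*k-1) (q t) a = real k * (2 * real k + 1) * L (2*k+1) (q t) a"
  shows "((\<lambda>s. \<Sum>k=1..l. - (s^(2*k) / (2 * real k) * contract2 (symcov1 g (L (2*k-1))) (q s) (v s))
                        + s^(2*k-1) * contract1 (L (2*k-1)) (q s) (v s)) has_real_derivative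
           (if l > 0 then contract1 (L 1) (q t) (v t) else 0)) (at t)"
proof -
  define S where "S k s = contract2 (symcov1 g (L (2*k-1))) (q s) (v s)" for k s
  define P where "P k s = contract1 (L (2*k-1)) (q s) (v s)" for k s
  define A where "A k = contract1 (Y (2*k-1)) (q t) (v t)" for k
  have "((\<lambda>s. \<Sum>k=1..l. - (s^(2*k) / (2 * real k) * S k s) + s^(2*k-1) * P k s) has_real_derivative
      (\<Sum>k=1..l. - (t^(2*k) / (2 * real k)) * (2 * E0 * A k) + real (2*k-1) * t^(2*k-2) * P k t)) (at t)"
  proof (rule DERIV_sum)
    fix k assume k: "k \<in> {1..l}"
    have "(S k has_real_derivative 2 * E0 * A k) (at t)" and "(P k has_real_derivative S k t) (at t)"
      unfolding S_def P_def A_def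
      by (rule symcov1_contract2_has_derivative[OF L[OF k] CKT[OF k]],
          rule smooth_covec_contract1_has_derivative[OF L[OF k]])
    from power_pair_has_derivative[of "2*k", OF _ this] k
    show "((\<lambda>s. - (s^(2*k) / (2 * real k) * S k s) + s^(2*k-1) * P k s) has_real_derivative
        - (t^(2*k) / (2 * real k)) * (2 * E0 * A k) + real (2*k-1) * t^(2*k-2) * P k t) (at t)"
      by simp
  qed
  moreover have "(\<Sum>k=1..l. - (t^(2*k) / (2 * real k)) * (2 * E0 * A k) + real (2*k-1) * t^(2*k-2) * P k t)
      = (if l > 0 then P 1 t else 0)"
  proof (rule telescope_odd_series)
    show "E0 * A l = 0" if "l \<ge> 1"
      using contract1_eq_scaled[of E0 "Y (2*l-1)" "q t" 0 "Y (2*l-1)" "v t"] top[OF that]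
      by (simp add: A_def)
    show "E0 * A k = real k * (2 * real k + 1) * P (k + 1) t" if "k \<in> {1..<l}" for k
      using contract1_eq_scaled[of E0 "Y (2*k-1)" "q t" _ "L (2*k+1)" "v t"] step[OF that]
      by (simp add: A_def P_def)
  qed
  moreover have "P 1 t = contract1 (L 1) (q t) (v t)" by (simp add: P_def)
  ultimately have "((\<lambda>s. \<Sum>k=1..l. - (s^(2*k) / (2 * real k) * S k s) + s^(2*k-1) * P k s)
      has_real_derivative (if l > 0 then contract1 (L 1) (q t) (v t) else 0)) (at t)"
    by (simp only:)
  then show ?thesis unfolding S_def P_def .
qed

lemma odd_series_integral_has_derivative_zero:
  assumes C: "smooth_tensor2 U C" and G: "smooth_fun U G"
    and L: "\<And>k. k \<in> {1..l} \<Longrightarrow> smooth_covec U (L (2*k-1))"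
    and CKT_C: "is_CKT U g C X"
    and CKT_L: "\<And>k. k \<in> {1..l} \<Longrightarrow> is_CKT U g (symcov1 g (L (2*k-1))) (Y (2*k-1))"
    and top: "\<And>a. l \<ge> 1 \<Longrightarrow> E0 * Y (2*l-1) (q t) a = 0"
    and step: "\<And>k a. k \<in> {1..<l} \<Longrightarrow>
                 E0 * Y (2*k-1) (q t) a = real k * (2 * real k + 1) * L (2*k+1) (q t) a"
    and pd_G: "\<And>a. pd G a (q t) = - 2 * E0 * X (q t) a - (if l > 0 then L 1 (q t) a else 0)"
  shows "((\<lambda>s. (\<Sum>k=1..l. - (s^(2*k) / (2 * real k) * contract2 (symcov1 g (L (2*k-1))) (q s) (v s))
                         + s^(2*k-1) * contract1 (L (2*k-1)) (q s) (v s))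
              + contract2 C (q s) (v s) + G (q s)) has_real_derivative 0) (at t)"
proof -
  define P1 where "P1 = (if l > 0 then contract1 (L 1) (q t) (v t) else 0)"
  define B where "B = contract1 X (q t) (v t)"
  have dC: "((\<lambda>s. contract2 C (q s) (v s)) has_real_derivative 2 * E0 * B) (at t)"
    unfolding B_def
    by (rule CKT_contract2_has_derivative[OF _ CKT_C]) (rule smooth_tensor2_differentiable[OF C in_domain])
  have "(\<Sum>c\<in>UNIV. pd G c (q t) * v t $ c) = - 2 * E0 * B - P1"
    unfolding pd_G B_def P1_def contract1_def
    by (cases "l > 0") (simp_all add: left_diff_distrib sum_subtractf sum_distrib_left mult.assoc)
  then have dG: "((\<lambda>s. G (q s)) has_real_derivative - 2 * E0 * B - P1) (at t)"
    using pd_chain_rule[OF smooth_fun_differentiable[OF G in_domain] velocity] by simp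
  from DERIV_add[OF DERIV_add[OF odd_series_has_derivative[OF L CKT_L top step] dC] dG]
  show ?thesis unfolding P1_def[symmetric] by simp
qed

end

lemma first_integralI:
  fixes g :: "real^'n \<Rightarrow> 'n \<Rightarrow> 'n \<Rightarrow> real" and I :: "real \<Rightarrow> real^'n \<Rightarrow> real^'n \<Rightarrow> real"
  assumes "is_metric U g"
    and "\<And>q v acc t. constrained_geodesic_at g q v acc t U E0 \<Longrightarrow>
           ((\<lambda>s. I s (q s) (v s)) has_real_derivative 0) (at t)"
  shows "first_integral U g E0 I"
  using assms
  unfolding first_integral_def constrained_geodesic_at_def geodesic_at_def
    constrained_geodesic_at_axioms_def contract2_def
  by blast

lemma first_integral_odd_series:
  assumes metric: "is_metric U g"
    and "smooth_tensor2 U C" "smooth_fun U G" "\<forall>k\<in>{1..l}. smooth_covec U (L (2*k-1))"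
    and "is_CKT U g C X" "\<forall>k\<in>{1..l}. is_CKT U g (symcov1 g (L (2*k-1))) (Y (2*k-1))"
    and "l \<ge> 1 \<longrightarrow> (\<forall>q\<in>U. \<forall>a. E0 * Y (2*l-1) q a = 0)"
    and "\<forall>k\<in>{1..<l}. \<forall>q\<in>U. \<forall>a. E0 * Y (2*k-1) q a = real k * (2 * real k + 1) * L (2*k+1) q a"
    and "\<forall>q\<in>U. \<forall>a. pd G a q = - 2 * E0 * X q a - (if l > 0 then L 1 q a else 0)"
  shows "first_integral U g E0
          (\<lambda>t q v. (\<Sum>a\<in>UNIV. \<Sum>b\<in>UNIV.
                (- (\<Sum>k=1..l. t^(2*k) / (2 * real k) * symcov1 g (L (2*k-1)) q a b) + C q a b)
                * v $ a * v $ b)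
             + (\<Sum>k=1..l. t^(2*k-1) * (\<Sum>a\<in>UNIV. L (2*k-1) q a * v $ a))
             + G q)"
  unfolding quadratic_form_combination sum_regroup
  by (rule first_integralI[OF metric],
      rule constrained_geodesic_at.odd_series_integral_has_derivative_zero[unfolded contract1_def contract2_def])
    (use assms in \<open>auto dest: constrained_geodesic_at.in_domain\<close>)

lemma first_integral_even_series:
  assumes metric: "is_metric U g"
    and "\<forall>k\<in>{0..l}. smooth_covec U (L (2*k))"
    and "\<forall>k\<in>{0..l}. is_CKT U g (symcov1 g (L (2*k))) (Y (2*k))"
    and "\<forall>q\<in>U. \<forall>a. E0 * Y (2*l) q a = 0"
    and "\<forall>k\<in>{0..<l}. \<forall>q\<in>U. \<forall>a. E0 * Y (2*k) q a = (real k + 1) * (2 * real k + 1) * L (2*k+2) q a"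
  shows "first_integral U g E0
          (\<lambda>t q v. \<Sum>k=0..l.
              - (t^(2*k+1) / (2 * real k + 1)) *
                  (\<Sum>a\<in>UNIV. \<Sum>b\<in>UNIV. symcov1 g (L (2*k)) q a b * v $ a * v $ b)
              + t^(2*k) * (\<Sum>a\<in>UNIV. L (2*k) q a * v $ a))"
  by (rule first_integralI[OF metric],
      rule constrained_geodesic_at.even_series_integral_has_derivative_zero[unfolded contract1_def contract2_def])
    (use assms in \<open>auto dest: constrained_geodesic_at.in_domain\<close>)

lemma first_integral_exponential:
  assumes metric: "is_metric U g"
    and "lam \<noteq> 0" "smooth_covec U L" "is_CKT U g (symcov1 g L) Y"
    and "\<forall>q\<in>U. \<forall>a. L q a = 2 * E0 / lam^2 * Y q a"
  shows "first_integral U g E0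
          (\<lambda>t q v. exp (lam * t) *
              (- (\<Sum>a\<in>UNIV. \<Sum>b\<in>UNIV. symcov1 g L q a b * v $ a * v $ b)
               + lam * (\<Sum>a\<in>UNIV. L q a * v $ a)))"
  by (rule first_integralI[OF metric],
      rule constrained_geodesic_at.exponential_integral_has_derivative_zero[unfolded contract1_def contract2_def])
    (use assms in \<open>auto dest: constrained_geodesic_at.in_domain\<close>)

theorem theorem2:
  fixes U :: "(real^'n) set" and g :: "real^'n \<Rightarrow> 'n \<Rightarrow> 'n \<Rightarrow> real" and E0 :: real
  assumes metric: "is_metric U g"
  shows
   "(\<forall>(l::nat) C X (L::nat \<Rightarrow> real^'n \<Rightarrow> 'n \<Rightarrow> real) Y G.
       smooth_tensor2 U C \<and> smooth_covec U X \<and> smooth_fun U G \<and>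
       (\<forall>k\<in>{1..l}. smooth_covec U (L (2*k-1)) \<and> smooth_covec U (Y (2*k-1))) \<and>
       is_CKT U g C X \<and>
       (\<forall>k\<in>{1..l}. is_CKT U g (symcov1 g (L (2*k-1))) (Y (2*k-1))) \<and>
       (l \<ge> 1 \<longrightarrow> (\<forall>q\<in>U. \<forall>a. E0 * Y (2*l-1) q a = 0)) \<and>
       (\<forall>k\<in>{1..<l}. \<forall>q\<in>U. \<forall>a. E0 * Y (2*k-1) q a = real k * (2 * real k + 1) * L (2*k+1) q a) \<and>
       (\<forall>q\<in>U. \<forall>a. pd G a q = - 2 * E0 * X q a - (if l > 0 then L 1 q a else 0))
     \<longrightarrow> first_integral U g E0
          (\<lambda>t q v. (\<Sum>a\<in>UNIV. \<Sum>b\<in>UNIV.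
                (- (\<Sum>k=1..l. t^(2*k) / (2 * real k) * symcov1 g (L (2*k-1)) q a b) + C q a b)
                * v $ a * v $ b)
             + (\<Sum>k=1..l. t^(2*k-1) * (\<Sum>a\<in>UNIV. L (2*k-1) q a * v $ a))
             + G q)) \<and>
    (\<forall>(l::nat) (L::nat \<Rightarrow> real^'n \<Rightarrow> 'n \<Rightarrow> real) Y.
       (\<forall>k\<in>{0..l}. smooth_covec U (L (2*k)) \<and> smooth_covec U (Y (2*k))) \<and>
       (\<forall>k\<in>{0..l}. is_CKT U g (symcov1 g (L (2*k))) (Y (2*k))) \<and>
       (\<forall>q\<in>U. \<forall>a. E0 * Y (2*l) q a = 0) \<and>
       (\<forall>k\<in>{0..<l}. \<forall>q\<in>U. \<forall>a. E0 * Y (2*k) q a = (real k + 1) * (2 * real k + 1) * L (2*k+2) q a)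
     \<longrightarrow> first_integral U g E0
          (\<lambda>t q v. \<Sum>k=0..l.
              - (t^(2*k+1) / (2 * real k + 1)) *
                  (\<Sum>a\<in>UNIV. \<Sum>b\<in>UNIV. symcov1 g (L (2*k)) q a b * v $ a * v $ b)
              + t^(2*k) * (\<Sum>a\<in>UNIV. L (2*k) q a * v $ a))) \<and>
    (\<forall>(lam::real) (L::real^'n \<Rightarrow> 'n \<Rightarrow> real) Y.
       lam \<noteq> 0 \<and> smooth_covec U L \<and> smooth_covec U Y \<and>
       is_CKT U g (symcov1 g L) Y \<and>
       (\<forall>q\<in>U. \<forall>a. L q a = 2 * E0 / lam^2 * Y q a)
     \<longrightarrow> first_integral U g E0
          (\<lambda>t q v. exp (lam * t) *
              (- (\<Sum>a\<in>UNIV. \<Sum>b\<in>UNIV. symcov1 g L q a b * v $ a * v $ b)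
               + lam * (\<Sum>a\<in>UNIV. L q a * v $ a))))"
  apply (intro conjI allI impI; elim conjE)
  subgoal by (rule first_integral_odd_series[OF metric]) blast+
  subgoal by (rule first_integral_even_series[OF metric]) blast+
  subgoal by (rule first_integral_exponential[OF metric]) blast+
  done

end
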